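(* Let $m_1,m_2\ge 0$ be any integers, let $t>0$ and $x\in(0,1/2)$ be real numbers. Then $$\exp\left(\sum_{\ell=1}^{2m_1+1}\frac{B_{2\ell}(x)-B_{2\ell}}{\ell(2\ell-1)}\frac{1}{t^{2\ell-1}}\right) < \frac{\Gamma(t+1-x)\Gamma(t+x)}{\Gamma(t)\Gamma(t+1)}< \exp\left(\sum_{\ell=1}^{2m_2}\frac{B_{2\ell}(x)-B_{2\ell}}{\ell(2\ell-1)}\frac{1}{t^{2\ell-1}}\right)$$ and $$\exp\left(\sum_{\ell=1}^{2m_1}\frac{B_{2\ell+1}(x)}{\ell(2\ell+1)}\frac{1}{t^{2\ell}}\right) < \frac{\Gamma(t+1-x)}{t^{1-2x}\Gamma(t+x)}< \exp\left(\sum_{\ell=1}^{2m_2+1}\frac{B_{2\ell+1}(x)}{\ell(2\ell+1)}\frac{1}{t^{2\ell}}\right).$$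
   Context: $\Gamma$ is Euler's gamma function. For each integer $n\ge 0$ and real $x$, the $n$th Bernoulli polynomial $B_n(x)$ is defined by $\sum_{n\ge 0}\frac{B_n(x)}{n!}s^n=\frac{se^{sx}}{e^s-1}$ for $|s|<2\pi$, and $B_n:=B_n(0)$ is the $n$th Bernoulli number. Empty sums are equal to $0$. *)

theory Defs
  imports "HOL-Complex_Analysis.Complex_Analysis"
begin

text \<open>
  The generating function \<open>s e\<^sup>s\<^sup>x / (e\<^sup>s - 1)\<close> is read as a quotient of formal power series in \<open>s\<close>;
  the denominator has a simple zero at \<open>0\<close>, which the numerator cancels. The lemmas
  \<open>bernpoly_sums\<close> and \<open>bernpoly_unique\<close> below show that this is the same as the analytic
  definition on \<open>\<bar>s\<bar> < 2\<pi>\<close>.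
\<close>

definition bernpoly :: "nat \<Rightarrow> real \<Rightarrow> real" where
  "bernpoly n x = fact n * fps_nth (fps_X * fps_exp x / (fps_exp 1 - 1)) n"

definition bernoulli :: "nat \<Rightarrow> real" where
  "bernoulli n = bernpoly n 0"

lemma fps_exp_minus_1_subdegree:
  "subdegree (fps_exp 1 - 1 :: 'a :: field_char_0 fps) = 1"
  by (rule subdegreeI) auto

lemma bernpoly_fps_mult:
  "(fps_X * fps_exp c / (fps_exp 1 - 1)) * (fps_exp 1 - 1) = 
     (fps_X * fps_exp c :: 'a :: field_char_0 fps)"
proof -
  have "(fps_exp 1 - 1 :: 'a fps) dvd fps_X * fps_exp c"
    by (subst fps_dvd_iff)
      (use fps_exp_minus_1_subdegree[where ?'a = 'a] in auto)
  thus ?thesis by simp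
qed

lemma exp_neq_1_of_norm_less:
  fixes s :: complex
  assumes "s \<noteq> 0" "norm s < 2 * pi"
  shows "exp s \<noteq> 1"
proof
  assume "exp s = 1"
  then obtain n :: int where n: "Re s = 0" "Im s = real_of_int (2 * n) * pi"
    by (auto simp: exp_eq_1)
  have "n \<noteq> 0" using n assms(1) by (auto simp: complex_eq_iff)
  hence "1 \<le> \<bar>real_of_int n\<bar>" by linarith
  hence "2 * pi * 1 \<le> 2 * pi * \<bar>real_of_int n\<bar>"
    by (intro mult_left_mono) auto
  also have "\<dots> = \<bar>Im s\<bar>" using n by (simp add: abs_mult)
  also have "\<dots> \<le> norm s" by (rule abs_Im_le_cmod)
  finally show False using assms(2) by simp
qed

lemma bernpoly_fps_of_real:
  "fps_nth (fps_X * fps_exp (complex_of_real x) / (fps_exp 1 - 1)) n = 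
     complex_of_real (bernpoly n x / fact n)"
proof -
  define F where "F = (fps_X * fps_exp x / (fps_exp 1 - 1) :: real fps)"
  define G where "G = Abs_fps (\<lambda>n. complex_of_real (fps_nth F n))"
  have F: "F * (fps_exp 1 - 1) = fps_X * fps_exp x"
    unfolding F_def by (rule bernpoly_fps_mult)
  have "G * (fps_exp 1 - 1) = fps_X * fps_exp (complex_of_real x)"
  proof (rule fps_ext)
    fix n
    have "fps_nth (G * (fps_exp 1 - 1)) n = 
            complex_of_real (fps_nth (F * (fps_exp 1 - 1)) n)"
      unfolding fps_mult_nth of_real_sum
      by (intro sum.cong) (auto simp: G_def)
    also have "\<dots> = fps_nth (fps_X * fps_exp (complex_of_real x)) n"
      unfolding F by simp
    finally show "fps_nth (G * (fps_exp 1 - 1)) n = \<dots>" .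
  qed
  also have "\<dots> = (fps_X * fps_exp (complex_of_real x) / (fps_exp 1 - 1)) * (fps_exp 1 - 1)"
    by (rule bernpoly_fps_mult [symmetric])
  finally have "G = fps_X * fps_exp (complex_of_real x) / (fps_exp 1 - 1)"
    using fps_exp_minus_1_subdegree[where ?'a = complex] by auto
  from this [symmetric] show ?thesis
    by (simp add: G_def F_def bernpoly_def)
qed

text \<open>At \<open>s = 0\<close> the generating function has a removable singularity with value \<open>1\<close>.\<close>

lemma bernpoly_sums:
  fixes s :: complex
  assumes "norm s < 2 * pi"
  shows "(\<lambda>n. complex_of_real (bernpoly n x) / fact n * s ^ n) sums
           (if s = 0 then 1 else s * exp (s * complex_of_real x) / (exp s - 1))"
proof -
  let ?f = "fps_X * fps_exp (complex_of_real x)" and ?g = "fps_exp 1 - 1 :: complex fps"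
  have cf: "fps_conv_radius ?f = \<infinity>"
    using fps_conv_radius_mult[of fps_X "fps_exp (complex_of_real x)"] by simp
  have cg: "fps_conv_radius ?g = \<infinity>"
    using fps_conv_radius_diff[of "fps_exp 1" "1 :: complex fps"] by simp
  have ef: "eval_fps ?f z = z * exp (complex_of_real x * z)" for z
    by (subst eval_fps_mult) auto
  have eg: "eval_fps ?g z = exp z - 1" for z
    by (subst eval_fps_diff) auto
  have nz: "eval_fps ?g z \<noteq> 0" if "z \<in> eball 0 (ereal (2 * pi))" "z \<noteq> 0" for z
    using exp_neq_1_of_norm_less[of z] that by (auto simp: eg)
  have sd: "subdegree ?g \<le> subdegree ?f"
    using fps_exp_minus_1_subdegree[where ?'a = complex] by simp
  have rad: "ereal (2 * pi) \<le> fps_conv_radius (?f / ?g)"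
    using fps_conv_radius_divide[of ?g ?f "ereal (2 * pi)", OF _ _ _ _ nz] sd cf cg
      fps_exp_minus_1_subdegree[where ?'a = complex] by (auto simp: min_def)
  have ev: "eval_fps (?f / ?g) s = (if s = 0 then 1 else eval_fps ?f s / eval_fps ?g s)"
    using eval_fps_divide[of ?g ?f "ereal (2 * pi)" s 1, OF _ _ _ _ nz] sd cf cg assms
      fps_exp_minus_1_subdegree[where ?'a = complex] by (auto simp: min_def)
  have "ereal (norm s) < fps_conv_radius (?f / ?g)"
    using rad assms by (meson ereal_less_eq less_le_trans less_ereal.simps(1))
  hence "(\<lambda>n. fps_nth (?f / ?g) n * s ^ n) sums eval_fps (?f / ?g) s"
    by (rule sums_eval_fps)
  thus ?thesis
    unfolding ev by (simp add: bernpoly_fps_of_real ef eg mult.commute cong: if_cong)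
qed

lemma bernpoly_sums_real:
  fixes s x :: real
  assumes "\<bar>s\<bar> < 2 * pi"
  shows "(\<lambda>n. bernpoly n x / fact n * s ^ n) sums
           (if s = 0 then 1 else s * exp (s * x) / (exp s - 1))"
proof -
  have "(\<lambda>n. complex_of_real (bernpoly n x / fact n * s ^ n)) sums
          complex_of_real (if s = 0 then 1 else s * exp (s * x) / (exp s - 1))"
    using bernpoly_sums[of "complex_of_real s" x] assms
    by (cases "s = 0") (simp_all add: exp_of_real [symmetric])
  thus ?thesis by (rule sums_of_real_iff[THEN iffD1])
qed

lemma bernpoly_unique:
  fixes b :: "nat \<Rightarrow> real"
  assumes "\<And>s. s \<noteq> 0 \<Longrightarrow> \<bar>s\<bar> < 2 * pi \<Longrightarrow>
             (\<lambda>n. b n / fact n * s ^ n) sums (s * exp (s * x) / (exp s - 1))"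
  shows "b n = bernpoly n x"
proof -
  define d where "d n = (b n - bernpoly n x) / fact n" for n
  have d: "(\<lambda>n. d n * s ^ n) sums 0" if "s \<noteq> 0" "\<bar>s\<bar> < 2 * pi" for s
    using sums_diff[OF assms[OF that] bernpoly_sums_real[OF that(2), of x]] that
    by (simp add: d_def algebra_simps diff_divide_distrib)
  have "((\<lambda>_. 0) \<longlongrightarrow> d 0) (at (0 :: real))"
    by (rule powser_limit_0_strong[of "2 * pi"]) (use d in auto)
  hence d0: "d 0 = 0"
    by (simp add: tendsto_const_iff)
  have d': "(\<lambda>n. d n * (s - 0) ^ n) sums 0" if "norm (s - 0) < 2 * pi" for s
    using d[of s] d0 that sums_unique2 powser_sums_zero[of d] by (cases "s = 0") auto
  have "d n = 0"
  proof (rule ccontr)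
    assume n: "d n \<noteq> 0"
    with d0 have "n > 0" by (cases n) auto
    show False
    proof (rule powser_0_nonzero[of "2 * pi" 0 d "\<lambda>_. 0" n])
      fix r :: real
      assume r: "0 < r" "\<And>z :: real. z \<in> cball 0 r - {0} \<Longrightarrow> (0 :: real) \<noteq> 0"
      show False using r(2)[of r] r(1) by simp
    qed (use d' n \<open>n > 0\<close> in auto)
  qed
  thus ?thesis by (simp add: d_def)
qed

end

theory Submission
  imports Defs
begin

text \<open>
  Fix \<open>t\<close> and regard the logarithms of the two gamma expressions, minus the exponents of the
  claimed bounds, as functions of \<open>x\<close> on \<open>[0, 1/2]\<close>. The sign of such a remainder follows
  from the sign of a derivative in \<open>x\<close> and from its values at the end points.

  Since \<open>B\<^sub>n' = n B\<^sub>n\<^sub>-\<^sub>1\<close>, the first \<open>x\<close>-derivative of the logarithm of the product and the second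
  \<open>x\<close>-derivative of the logarithm of the quotient are again of one common shape: a difference
  \<open>\<plusminus>(\<psi>\<^sub>k(t + x) - \<psi>\<^sub>k(t + 1 - x))\<close> of polygamma values minus a sum over the \<open>B\<^sub>2\<^sub>l\<^sub>+\<^sub>1(x)\<close>,
  namely \<open>polygamma_remainder k n t x\<close> with \<open>k = 0\<close> and \<open>k = 1\<close>. The family of these functions
  is closed under two further differentiations: two \<open>x\<close>-derivatives of the remainder \<open>(k, n + 1)\<close>
  give the remainder \<open>(k + 2, n)\<close>. The remainder \<open>(k, n + 1)\<close> vanishes at \<open>0\<close>, by the recurrence
  of \<open>\<psi>\<^sub>k\<close> and because \<open>B\<^sub>1(0) = -1/2\<close> and the later \<open>B\<^sub>2\<^sub>l\<^sub>+\<^sub>1(0)\<close> are zero, and it vanishes at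
  \<open>1/2\<close> by symmetry. A strictly convex function that vanishes at both ends of an interval is
  negative inside, so each step \<open>n \<rightarrow> n + 1\<close> reverses the sign; for \<open>n = 0\<close> the sign is the strict
  monotonicity of \<open>\<psi>\<^sub>k\<close>. This is \<open>polygamma_remainder_sign\<close>.

  The remainder of the product vanishes at \<open>x = 0\<close> and inherits the sign of its derivative
  (\<open>ln_Gamma_product_remainder_sign\<close>); that of the quotient vanishes at \<open>0\<close> and \<open>1/2\<close>, and the
  convexity argument applies once more (\<open>ln_Gamma_quotient_remainder_sign\<close>). The parities in
  the four bounds are the values of \<open>n\<close> with the right sign.
\<close>

section \<open>Bernoulli polynomials\<close>

lemma bernpoly_eq_sum:
  "bernpoly n x = fact n * (\<Sum>i\<le>n. x ^ i / fact i * (bernoulli (n - i) / fact (n - i)))"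
proof -
  let ?D = "fps_exp 1 - 1 :: real fps"
  have "fps_X * fps_exp x / ?D * ?D = fps_exp x * (fps_X * fps_exp 0 / ?D * ?D)"
    by (simp only: bernpoly_fps_mult) (simp add: mult_ac)
  also have "\<dots> = fps_exp x * (fps_X * fps_exp 0 / ?D) * ?D"
    by (rule mult.assoc [symmetric])
  finally have "fps_X * fps_exp x / ?D = fps_exp x * (fps_X * fps_exp 0 / ?D)"
    using fps_exp_minus_1_subdegree[where ?'a = real] by auto
  thus ?thesis
    by (simp add: bernpoly_def bernoulli_def fps_mult_nth atLeast0AtMost)
qed

lemma has_real_derivative_bernpoly:
  "(bernpoly n has_real_derivative real n * bernpoly (n - 1) x) (at x within A)"
proof (cases n)
  case 0
  have "bernpoly n = (\<lambda>_. bernpoly n 0)"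
    by (rule ext) (simp add: 0 bernpoly_eq_sum)
  thus ?thesis using 0 by (metis DERIV_const mult_zero_left of_nat_0)
next
  case (Suc m)
  define c where "c i = bernoulli (n - i) / fact (n - i)" for i
  have "((\<lambda>x. fact n * (\<Sum>i\<le>n. x ^ i / fact i * c i)) has_real_derivative
      fact n * (\<Sum>i\<le>n. real i * x ^ (i - 1) / fact i * c i)) (at x within A)"
    by (auto intro!: derivative_eq_intros sum.cong)
  also have "(\<Sum>i\<le>n. real i * x ^ (i - 1) / fact i * c i) =
      (\<Sum>i\<le>m. x ^ i / fact i * c (Suc i))"
    unfolding Suc by (subst sum.atMost_Suc_shift) (simp add: divide_simps del: of_nat_Suc)
  also have "fact n * \<dots> = real n * bernpoly (n - 1) x"
    by (simp add: Suc bernpoly_eq_sum c_def)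
  finally show ?thesis
    by (simp add: bernpoly_eq_sum[abs_def] c_def)
qed

lemmas has_real_derivative_bernpoly_chain [derivative_intros] =
  has_real_derivative_bernpoly [THEN DERIV_chain2]

text \<open>
  The generating function \<open>s e\<^sup>s\<^sup>x / (e\<^sup>s - 1)\<close> is invariant under \<open>(s, x) \<mapsto> (-s, 1 - x)\<close>.
\<close>

lemma bernpoly_reflect: "bernpoly n (1 - x) = (-1) ^ n * bernpoly n x"
proof (rule bernpoly_unique [symmetric])
  fix s :: real
  assume s: "s \<noteq> 0" "\<bar>s\<bar> < 2 * pi"
  have "(\<lambda>n. bernpoly n x / fact n * (- s) ^ n) sums (- s * exp (- s * x) / (exp (- s) - 1))"
    using bernpoly_sums_real[of "- s" x] s by simp
  moreover have "- s * exp (- s * x) / (exp (- s) - 1) = s * exp (s * (1 - x)) / (exp s - 1)"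
    using s by (simp add: exp_minus exp_diff algebra_simps divide_simps)
  ultimately show "(\<lambda>n. (-1) ^ n * bernpoly n x / fact n * s ^ n) sums
      (s * exp (s * (1 - x)) / (exp s - 1))"
    by (simp add: power_minus[of s] mult_ac)
qed

text \<open>The generating functions for \<open>x = 1\<close> and \<open>x = 0\<close> differ by \<open>s\<close> alone.\<close>

lemma bernpoly_1: "bernpoly n 1 = bernoulli n + (if n = 1 then 1 else 0)"
proof (rule bernpoly_unique [symmetric])
  fix s :: real
  assume s: "s \<noteq> 0" "\<bar>s\<bar> < 2 * pi"
  have "(\<lambda>n. bernpoly n 0 / fact n * s ^ n + (if n = 1 then s ^ n else 0)) sums
      (s / (exp s - 1) + s ^ 1)"
    using bernpoly_sums_real[of s 0] s by (intro sums_add sums_single) simp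
  moreover have "s / (exp s - 1) + s ^ 1 = s * exp (s * 1) / (exp s - 1)"
    using s by (simp add: field_simps)
  moreover have "bernpoly n 0 / fact n * s ^ n + (if n = 1 then s ^ n else 0) =
      (bernoulli n + (if n = 1 then 1 else 0)) / fact n * s ^ n" for n
    by (simp add: bernoulli_def field_simps)
  ultimately show "(\<lambda>n. (bernoulli n + (if n = 1 then 1 else 0)) / fact n * s ^ n) sums
      (s * exp (s * 1) / (exp s - 1))"
    by simp
qed

lemma bernpoly_odd_0: "bernpoly (2 * l + 1) 0 = (if l = 0 then - 1 / 2 else 0)"
  using bernpoly_reflect[of "2 * l + 1" 0] bernpoly_1[of "2 * l + 1"]
  by (auto simp: bernoulli_def)

lemma bernpoly_odd_half: "bernpoly (2 * l + 1) (1 / 2) = 0"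
  using bernpoly_reflect[of "2 * l + 1" "1 / 2"] by simp

section \<open>Convex functions vanishing at two points\<close>

text \<open>
  If \<open>f x \<ge> 0\<close>, then the mean value theorem yields a point left of \<open>x\<close> with \<open>f' \<ge> 0\<close> and one right
  of \<open>x\<close> with \<open>f' \<le> 0\<close>, which contradicts that \<open>f'\<close> is strictly increasing.
\<close>

lemma pos_second_deriv_imp_neg:
  fixes f f' f'' :: "real \<Rightarrow> real"
  assumes f: "\<And>y. a \<le> y \<Longrightarrow> y \<le> b \<Longrightarrow> (f has_real_derivative f' y) (at y)"
    and f': "\<And>y. a \<le> y \<Longrightarrow> y \<le> b \<Longrightarrow> (f' has_real_derivative f'' y) (at y)"
    and pos: "\<And>y. a < y \<Longrightarrow> y < b \<Longrightarrow> f'' y > 0"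
    and zero: "f a = 0" "f b = 0" and x: "a < x" "x < b"
  shows "f x < 0"
proof (rule ccontr)
  assume "\<not> f x < 0"
  obtain u where u: "a < u" "u < x" "f x - f a = (x - a) * f' u"
    using MVT2[of a x f f'] f x by force
  obtain v where v: "x < v" "v < b" "f b - f x = (b - x) * f' v"
    using MVT2[of x b f f'] f x by force
  have "f' u \<ge> 0" "f' v \<le> 0"
    using u v zero x \<open>\<not> f x < 0\<close>
    by (smt (verit) mult_pos_neg, smt (verit) mult_pos_pos)
  moreover obtain w where "u < w" "w < v" "f' v - f' u = (v - u) * f'' w"
    using MVT2[of u v f' f''] f' u v by force
  moreover have "(v - u) * f'' w > 0"
    using \<open>u < w\<close> \<open>w < v\<close> u v by (intro mult_pos_pos pos) auto
  ultimately show False by linarith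
qed

section \<open>Differences of polygamma functions\<close>

text \<open>
  Up to sign this is the \<open>(k + 1)\<close>st \<open>t\<close>-derivative of \<open>ln \<Gamma>(t + 1 - x) - ln \<Gamma>(t + x)\<close> minus that of
  the first \<open>n\<close> terms of its asymptotic expansion; the term \<open>l = 0\<close> comes from \<open>(1 - 2x) ln t\<close>.
  The \<open>t\<close>-derivatives are written out, so that \<open>t\<close> can stay fixed in all proofs below.
\<close>

definition polygamma_remainder :: "nat \<Rightarrow> nat \<Rightarrow> real \<Rightarrow> real \<Rightarrow> real" where
  "polygamma_remainder k n t x =
     (-1) ^ k * (Polygamma k (t + x) - Polygamma k (t + 1 - x)) -
     (\<Sum>l<n. 2 * fact (2 * l + k) / fact (2 * l + 1) * bernpoly (2 * l + 1) x / t ^ (2 * l + k + 1))"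

text \<open>
  As \<open>(-1)\<^sup>k \<psi>\<^sub>k\<close> is strictly increasing, the case \<open>n = 0\<close> holds for every \<open>k\<close>. The induction must
  range over all \<open>k\<close>, since the step lowers \<open>n\<close> at the price of replacing \<open>k\<close> by \<open>k + 2\<close>.
\<close>

lemma polygamma_remainder_sign:
  assumes "t > 0" "0 < x" "x < 1 / 2"
  shows "(-1) ^ n * polygamma_remainder k n t x < 0"
  using assms(2,3)
proof (induction n arbitrary: k x)
  case 0
  show ?case
  proof (cases "even k")
    case True
    thus ?thesis using Polygamma_real_strict_mono[of "t + x" "t + 1 - x" k] 0 \<open>t > 0\<close>
      by (simp add: polygamma_remainder_def)
  next
    case False
    thus ?thesis using Polygamma_real_strict_antimono[of "t + x" "t + 1 - x" k] 0 \<open>t > 0\<close>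
      by (simp add: polygamma_remainder_def)
  qed
next
  case (Suc n)
  define a where "a l = 2 * fact (2 * l + k) / fact (2 * l + 1) / t ^ (2 * l + k + 1)" for l
  define s :: real where "s = (-1) ^ Suc n"
  have R: "polygamma_remainder k (Suc n) t =
      (\<lambda>x. (-1) ^ k * (Polygamma k (t + x) - Polygamma k (t + 1 - x)) -
        (\<Sum>l<Suc n. a l * bernpoly (2 * l + 1) x))"
    by (simp add: fun_eq_iff polygamma_remainder_def a_def)
  define f' where "f' y = s * ((-1) ^ k * (Polygamma (Suc k) (t + y) + Polygamma (Suc k) (t + 1 - y)) -
        (\<Sum>l<Suc n. a l * (real (2 * l + 1) * bernpoly (2 * l) y)))" for y
  have nonpos: "t + y \<notin> \<int>\<^sub>\<le>\<^sub>0" "t + 1 - y \<notin> \<int>\<^sub>\<le>\<^sub>0" if "0 \<le> y" "y \<le> 1 / 2" for y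
    using that \<open>t > 0\<close> by (auto elim!: nonpos_Ints_cases)
  show ?case
  proof (rule pos_second_deriv_imp_neg[of 0 "1/2" "\<lambda>y. (-1) ^ Suc n * polygamma_remainder k (Suc n) t y"
        f' "\<lambda>y. s * polygamma_remainder (k + 2) n t y"])
    fix y :: real
    assume y: "0 \<le> y" "y \<le> 1 / 2"
    show "((\<lambda>x. (-1) ^ Suc n * polygamma_remainder k (Suc n) t x) has_real_derivative f' y) (at y)"
      unfolding R f'_def s_def using nonpos[OF y]
      by (auto intro!: derivative_eq_intros sum.cong simp: algebra_simps)
    \<comment> \<open>Two differentiations remove the linear term \<open>l = 0\<close> and shift the others down by one index,
        which turns the powers of \<open>t\<close> into those belonging to \<open>k + 2\<close>.\<close>
    have "(\<Sum>l<Suc n. a l * (real (2 * l + 1) * (real (2 * l) * bernpoly (2 * l - 1) y))) =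
        (\<Sum>l<n. 2 * fact (2 * l + (k + 2)) / fact (2 * l + 1) * bernpoly (2 * l + 1) y
           / t ^ (2 * l + (k + 2) + 1))"
      unfolding sum.lessThan_Suc_shift
    proof (simp only: mult_0_right of_nat_0 mult_zero_left mult_zero_right add_0, rule sum.cong)
      fix l
      have "fact (2 * Suc l + 1) =
          real (2 * Suc l + 1) * (real (2 * Suc l) * fact (2 * l + 1))"
        by (simp add: algebra_simps)
      moreover have "2 * Suc l + k = 2 * l + (k + 2)" "2 * Suc l - 1 = 2 * l + 1" by simp_all
      ultimately show "a (Suc l) *
            (real (2 * Suc l + 1) * (real (2 * Suc l) * bernpoly (2 * Suc l - 1) y)) =
          2 * fact (2 * l + (k + 2)) / fact (2 * l + 1) * bernpoly (2 * l + 1) y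
            / t ^ (2 * l + (k + 2) + 1)"
        by (simp only: a_def) (simp add: divide_simps del: of_nat_Suc of_nat_add of_nat_mult fact_Suc)
    qed simp
    hence "s * polygamma_remainder (k + 2) n t y =
        s * ((-1) ^ k * (Polygamma (k + 2) (t + y) - Polygamma (k + 2) (t + 1 - y)) -
        (\<Sum>l<Suc n. a l * (real (2 * l + 1) * (real (2 * l) * bernpoly (2 * l - 1) y))))"
      by (simp add: polygamma_remainder_def)
    also have "(f' has_real_derivative \<dots>) (at y)"
      unfolding f'_def[abs_def] using nonpos[OF y]
      by (auto intro!: derivative_eq_intros sum.cong simp: algebra_simps)
    finally show "(f' has_real_derivative s * polygamma_remainder (k + 2) n t y) (at y)" .
  next
    fix y :: real
    assume "0 < y" "y < 1 / 2"
    from Suc.IH[OF this, of "k + 2"] show "s * polygamma_remainder (k + 2) n t y > 0"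
      by (simp add: s_def)
  next
    \<comment> \<open>At \<open>x = 0\<close> only the term with \<open>B\<^sub>1(0) = -1/2\<close> is left; it is the increment in
        \<open>\<psi>\<^sub>k(t + 1) = \<psi>\<^sub>k(t) + (-1)\<^sup>k k! / t\<^sup>k\<^sup>+\<^sup>1\<close>.\<close>
    have "(\<Sum>l<Suc n. a l * bernpoly (2 * l + 1) 0) = - fact k / t ^ Suc k"
      by (simp only: sum.lessThan_Suc_shift bernpoly_odd_0) (simp add: a_def)
    thus "(-1) ^ Suc n * polygamma_remainder k (Suc n) t 0 = 0"
      unfolding R using \<open>t > 0\<close> Polygamma_plus1[of t k] by (simp add: algebra_simps)
  next
    show "(-1) ^ Suc n * polygamma_remainder k (Suc n) t (1 / 2) = 0"
      unfolding R bernpoly_odd_half by (simp add: add.commute)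
  qed (use Suc.prems in auto)
qed

section \<open>Products and quotients of gamma values\<close>

text \<open>
  Differentiating in \<open>x\<close> turns the even Bernoulli polynomials into odd ones and removes the
  constants \<open>B\<^sub>2\<^sub>l\<close>, which make the remainder vanish at \<open>x = 0\<close>. What is left is
  \<open>polygamma_remainder 0 n\<close>, and the mean value theorem on \<open>[0, x]\<close> transfers its sign.
\<close>

lemma ln_Gamma_product_remainder_sign:
  assumes "t > 0" "0 < x" "x < 1 / 2"
  shows "(-1) ^ n * (ln_Gamma (t + 1 - x) + ln_Gamma (t + x) - ln_Gamma t - ln_Gamma (t + 1) -
     (\<Sum>l = 1..n. (bernpoly (2 * l) x - bernoulli (2 * l)) / (real l * (2 * real l - 1)) *
       (1 / t ^ (2 * l - 1)))) < 0"
proof -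
  define c where "c l = 1 / (real l * (2 * real l - 1)) * (1 / t ^ (2 * l - 1))" for l
  define f where "f y = (-1) ^ n * (ln_Gamma (t + 1 - y) + ln_Gamma (t + y) - ln_Gamma t -
      ln_Gamma (t + 1) - (\<Sum>l = 1..n. c l * (bernpoly (2 * l) y - bernoulli (2 * l))))" for y
  have f': "(f has_real_derivative (-1) ^ n * polygamma_remainder 0 n t y) (at y)"
    if "0 \<le> y" "y \<le> x" for y
  proof -
    have "(\<Sum>l = 1..n. c l * (real (2 * l) * bernpoly (2 * l - 1) y)) =
        (\<Sum>l<n. 2 * fact (2 * l + 0) / fact (2 * l + 1) * bernpoly (2 * l + 1) y / t ^ (2 * l + 0 + 1))"
      unfolding sum.atLeast1_atMost_eq [folded One_nat_def]
    proof (rule sum.cong)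
      fix l
      have "2 * real (Suc l) - 1 = real (2 * l + 1)" "2 * Suc l - 1 = 2 * l + 1" by simp_all
      thus "c (Suc l) * (real (2 * Suc l) * bernpoly (2 * Suc l - 1) y) =
          2 * fact (2 * l + 0) / fact (2 * l + 1) * bernpoly (2 * l + 1) y / t ^ (2 * l + 0 + 1)"
        using assms(1) by (simp add: c_def divide_simps del: of_nat_Suc of_nat_add of_nat_mult)
    qed simp
    hence "(-1) ^ n * polygamma_remainder 0 n t y = (-1) ^ n * (Digamma (t + y) - Digamma (t + 1 - y) -
        (\<Sum>l = 1..n. c l * (real (2 * l) * bernpoly (2 * l - 1) y)))"
      by (simp add: polygamma_remainder_def)
    also have "(f has_real_derivative \<dots>) (at y)"
      unfolding f_def[abs_def] using that assms
      by (auto intro!: derivative_eq_intros sum.cong simp: algebra_simps)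
    finally show ?thesis .
  qed
  obtain z where z: "0 < z" "z < x" "f x - f 0 = (x - 0) * ((-1) ^ n * polygamma_remainder 0 n t z)"
    using MVT2[of 0 x f, OF _ f'] assms by blast
  have "f 0 = 0"
    by (simp add: f_def bernoulli_def)
  with z have "f x = x * ((-1) ^ n * polygamma_remainder 0 n t z)" by simp
  also have "\<dots> < 0"
    using polygamma_remainder_sign[of t z n 0] z assms by (blast intro: mult_pos_neg less_trans)
  finally show ?thesis by (simp add: f_def c_def)
qed

text \<open>
  The term \<open>(1 - 2x) ln t\<close> is linear in \<open>x\<close>, so the second \<open>x\<close>-derivative is exactly
  \<open>polygamma_remainder 1 n\<close>. At \<open>x = 0\<close> the remainder vanishes because of
  \<open>\<Gamma>(t + 1) = t \<Gamma>(t)\<close>, at \<open>x = 1/2\<close> because of the symmetry \<open>x \<mapsto> 1 - x\<close>.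
\<close>

lemma ln_Gamma_quotient_remainder_sign:
  assumes "t > 0" "0 < x" "x < 1 / 2"
  shows "(-1) ^ n * (ln_Gamma (t + 1 - x) - ln_Gamma (t + x) - (1 - 2 * x) * ln t -
     (\<Sum>l = 1..n. bernpoly (2 * l + 1) x / (real l * (2 * real l + 1)) * (1 / t ^ (2 * l)))) > 0"
proof -
  define c where "c l = 1 / (real l * (2 * real l + 1)) * (1 / t ^ (2 * l))" for l
  define s :: real where "s = - ((-1) ^ n)"
  define f where "f y = s * (ln_Gamma (t + 1 - y) - ln_Gamma (t + y) - (1 - 2 * y) * ln t -
      (\<Sum>l = 1..n. c l * bernpoly (2 * l + 1) y))" for y
  define f' where "f' y = s * (- Digamma (t + 1 - y) - Digamma (t + y) + 2 * ln t -
      (\<Sum>l = 1..n. c l * (real (2 * l + 1) * bernpoly (2 * l) y)))" for y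
  have nonpos: "t + y \<notin> \<int>\<^sub>\<le>\<^sub>0" "t + 1 - y \<notin> \<int>\<^sub>\<le>\<^sub>0" if "0 \<le> y" "y \<le> 1 / 2" for y
    using that \<open>t > 0\<close> by (auto elim!: nonpos_Ints_cases)
  have "f x < 0"
  proof (rule pos_second_deriv_imp_neg[of 0 "1/2" f f' "\<lambda>y. s * polygamma_remainder 1 n t y"])
    fix y :: real
    assume y: "0 \<le> y" "y \<le> 1 / 2"
    show "(f has_real_derivative f' y) (at y)"
      unfolding f'_def f_def[abs_def] using y \<open>t > 0\<close>
      by (auto intro!: derivative_eq_intros sum.cong simp: algebra_simps)
    have "(\<Sum>l = 1..n. c l * (real (2 * l + 1) * (real (2 * l) * bernpoly (2 * l - 1) y))) =
        (\<Sum>l<n. 2 * fact (2 * l + 1) / fact (2 * l + 1) * bernpoly (2 * l + 1) y / t ^ (2 * l + 1 + 1))"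
      unfolding sum.atLeast1_atMost_eq [folded One_nat_def]
    proof (rule sum.cong)
      fix l
      have "2 * real (Suc l) + 1 = real (2 * Suc l + 1)" "2 * Suc l - 1 = 2 * l + 1" by simp_all
      thus "c (Suc l) * (real (2 * Suc l + 1) * (real (2 * Suc l) * bernpoly (2 * Suc l - 1) y)) =
          2 * fact (2 * l + 1) / fact (2 * l + 1) * bernpoly (2 * l + 1) y / t ^ (2 * l + 1 + 1)"
        using assms(1) by (simp add: c_def divide_simps del: of_nat_Suc of_nat_add of_nat_mult)
    qed simp
    hence "s * polygamma_remainder 1 n t y = s * (Polygamma 1 (t + 1 - y) - Polygamma 1 (t + y) -
        (\<Sum>l = 1..n. c l * (real (2 * l + 1) * (real (2 * l) * bernpoly (2 * l - 1) y))))"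
      by (simp add: polygamma_remainder_def)
    also have "(f' has_real_derivative \<dots>) (at y)"
      unfolding f'_def[abs_def] using nonpos[OF y]
      by (auto intro!: derivative_eq_intros sum.cong simp: algebra_simps)
    finally show "(f' has_real_derivative s * polygamma_remainder 1 n t y) (at y)" .
  next
    fix y :: real
    assume "0 < y" "y < 1 / 2"
    thus "s * polygamma_remainder 1 n t y > 0"
      using polygamma_remainder_sign[of t y n 1] \<open>t > 0\<close> by (simp add: s_def)
  next
    have "ln_Gamma (t + 1) - ln_Gamma t = ln t"
      using \<open>t > 0\<close> nonpos[of 0] Gamma_real_pos[of t]
      by (simp add: ln_Gamma_real_pos Gamma_plus1 ln_mult_pos)
    moreover have "(\<Sum>l = 1..n. c l * bernpoly (2 * l + 1) 0) = 0"
      by (simp only: bernpoly_odd_0) simp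
    ultimately show "f 0 = 0" by (simp add: f_def)
  next
    show "f (1 / 2) = 0" unfolding f_def bernpoly_odd_half by (simp add: add.commute)
  qed (use assms in auto)
  thus ?thesis by (simp add: f_def c_def s_def)
qed

theorem theorem3p1:
  fixes m1 m2 :: nat and t x :: real
  assumes "t > 0" and "0 < x" and "x < 1 / 2"
  shows
    "exp (\<Sum>l = 1..2 * m1 + 1.
        (bernpoly (2 * l) x - bernoulli (2 * l)) / (real l * (2 * real l - 1)) * (1 / t ^ (2 * l - 1)))
      < Gamma (t + 1 - x) * Gamma (t + x) / (Gamma t * Gamma (t + 1))
    \<and> Gamma (t + 1 - x) * Gamma (t + x) / (Gamma t * Gamma (t + 1))
      < exp (\<Sum>l = 1..2 * m2.
        (bernpoly (2 * l) x - bernoulli (2 * l)) / (real l * (2 * real l - 1)) * (1 / t ^ (2 * l - 1)))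
    \<and> exp (\<Sum>l = 1..2 * m1.
        bernpoly (2 * l + 1) x / (real l * (2 * real l + 1)) * (1 / t ^ (2 * l)))
      < Gamma (t + 1 - x) / (t powr (1 - 2 * x) * Gamma (t + x))
    \<and> Gamma (t + 1 - x) / (t powr (1 - 2 * x) * Gamma (t + x))
      < exp (\<Sum>l = 1..2 * m2 + 1.
        bernpoly (2 * l + 1) x / (real l * (2 * real l + 1)) * (1 / t ^ (2 * l)))"
proof -
  have product: "Gamma (t + 1 - x) * Gamma (t + x) / (Gamma t * Gamma (t + 1)) =
      exp (ln_Gamma (t + 1 - x) + ln_Gamma (t + x) - ln_Gamma t - ln_Gamma (t + 1))"
    using assms by (simp add: exp_add exp_diff Gamma_real_pos_exp)
  have quotient: "Gamma (t + 1 - x) / (t powr (1 - 2 * x) * Gamma (t + x)) =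
      exp (ln_Gamma (t + 1 - x) - ln_Gamma (t + x) - (1 - 2 * x) * ln t)"
    using assms by (simp add: exp_diff Gamma_real_pos_exp powr_def)
  show ?thesis
    unfolding product quotient exp_less_cancel_iff
    using ln_Gamma_product_remainder_sign[OF assms, of "2 * m1 + 1"]
      ln_Gamma_product_remainder_sign[OF assms, of "2 * m2"]
      ln_Gamma_quotient_remainder_sign[OF assms, of "2 * m1"]
      ln_Gamma_quotient_remainder_sign[OF assms, of "2 * m2 + 1"]
    by simp
qed

end
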